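(* If $\Gamma$ is a completely reducible game of size $2n+1$, then $$d(\Gamma,\Gamma^{-1}) \ = \ \beta(\Gamma) \ \leq \ n^2.$$
   Context: A tournament on a finite set $I$ is a relation $\Gamma\subset I\times I$ without loops such that for distinct $i,j$ exactly one of $(i,j),(j,i)$ is in $\Gamma$; a game of size $2n+1$ is a tournament on a set of size $2n+1$ in which every vertex has $n$ outputs and $n$ inputs. $\Gamma^{-1}=\{(j,i):(i,j)\in\Gamma\}$. A game $\Gamma$ on $I$ with $|I|=2n+1$ is completely reducible when there is a sequence of subsets $I_1\subset I_2\subset\dots\subset I_n=I$ with $|I_k|=2k+1$ such that each restriction $\Gamma\cap(I_k\times I_k)$ is a game on $I_k$. A $k$-cycle ($k\ge3$) is a digraph $\{(i_1,i_2),\dots,(i_{k-1},i_k),(i_k,i_1)\}$ with $i_1,\dots,i_k$ distinct. For an Eulerian digraph $\Delta$ (every vertex has as many outputs as inputs), the span $\sigma(\Delta)$ is the maximum cardinality of a set of pairwise edge-disjoint cycles with union $\Delta$, and $\beta(\Delta)=|\Delta|-2\sigma(\Delta)$, where $|\Delta|$ is the number of edges. The distance $d(\Gamma,\Pi)$ between two games on the same vertex set is the minimum number of $3$-cycle reversals needed to get from $\Gamma$ to $\Pi$, where one reversal replaces a game $\Gamma$ by $(\Gamma\setminus C)\cup C^{-1}$ for a $3$-cycle $C\subset\Gamma$. *)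

theory Defs
  imports Main "HOL-Library.Extended_Nat" "HOL-Library.Disjoint_Sets"
begin

definition tournament :: "'a set \<Rightarrow> 'a rel \<Rightarrow> bool" where
  "tournament I \<Gamma> \<longleftrightarrow>
     finite I \<and> \<Gamma> \<subseteq> I \<times> I \<and> irrefl \<Gamma> \<and>
     (\<forall>i\<in>I. \<forall>j\<in>I. i \<noteq> j \<longrightarrow> ((i, j) \<in> \<Gamma> \<longleftrightarrow> (j, i) \<notin> \<Gamma>))"

definition game :: "nat \<Rightarrow> 'a set \<Rightarrow> 'a rel \<Rightarrow> bool" where
  "game n I \<Gamma> \<longleftrightarrow>
     tournament I \<Gamma> \<and> card I = 2 * n + 1 \<and>
     (\<forall>i\<in>I. card {j. (i, j) \<in> \<Gamma>} = n \<and> card {j. (j, i) \<in> \<Gamma>} = n)"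

text \<open>The value \<open>J 0\<close> is unconstrained unless \<open>n = 0\<close>; the trivial game on one vertex
  is completely reducible, its chain of subsets being empty.\<close>

definition completely_reducible :: "nat \<Rightarrow> 'a set \<Rightarrow> 'a rel \<Rightarrow> bool" where
  "completely_reducible n I \<Gamma> \<longleftrightarrow>
     game n I \<Gamma> \<and>
     (\<exists>J :: nat \<Rightarrow> 'a set.
        J n = I \<and>
        (\<forall>k\<in>{1..<n}. J k \<subseteq> J (Suc k)) \<and>
        (\<forall>k\<in>{1..n}. card (J k) = 2 * k + 1 \<and> game k (J k) (\<Gamma> \<inter> (J k \<times> J k))))"

definition kcycle :: "nat \<Rightarrow> 'a rel \<Rightarrow> bool" where
  "kcycle k C \<longleftrightarrow>
     k \<ge> 3 \<and>
     (\<exists>vs. length vs = k \<and> distinct vs \<and> C = {(vs ! i, vs ! (Suc i mod k)) | i. i < k})"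

definition cycle_decomposition :: "'a rel \<Rightarrow> 'a rel set \<Rightarrow> bool" where
  "cycle_decomposition \<Delta> D \<longleftrightarrow> (\<forall>C\<in>D. \<exists>k. kcycle k C) \<and> disjoint D \<and> \<Union>D = \<Delta>"

text \<open>Meaningful when \<open>\<Delta>\<close> is finite and has a cycle decomposition, as every game does, being
  an Eulerian digraph without loops and without pairs of opposite edges.\<close>

definition digraph_span :: "'a rel \<Rightarrow> nat" where
  "digraph_span \<Delta> = Max {card D | D. cycle_decomposition \<Delta> D}"

lemma card_kcycle:
  assumes "kcycle k C"
  shows "card C = k"
proof -
  from assms obtain vs where vs: "length vs = k" "distinct vs"
    and C: "C = {(vs ! i, vs ! (Suc i mod k)) | i. i < k}"
    unfolding kcycle_def by blast
  have "C = (\<lambda>i. (vs ! i, vs ! (Suc i mod k))) ` {..<k}"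
    using C by auto
  moreover have "inj_on (\<lambda>i. (vs ! i, vs ! (Suc i mod k))) {..<k}"
    using vs by (auto simp: inj_on_def nth_eq_iff_index_eq)
  ultimately show ?thesis
    by (simp add: card_image)
qed

lemma cycle_decomposition_card:
  assumes "finite \<Delta>" and "cycle_decomposition \<Delta> D"
  shows "3 * card D \<le> card \<Delta>"
proof -
  have D: "\<Union>D = \<Delta>" "disjoint D"
    using assms(2) by (simp_all add: cycle_decomposition_def)
  have ge: "3 \<le> card C" if C: "C \<in> D" for C
  proof -
    from assms(2) C obtain k where k: "kcycle k C"
      unfolding cycle_decomposition_def by blast
    then have "3 \<le> k"
      by (simp add: kcycle_def)
    with card_kcycle[OF k] show ?thesis
      by simp
  qed
  have fin: "finite C" if "C \<in> D" for C
    using ge[OF that] by (intro card_ge_0_finite) linarith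
  have "3 * card D = (\<Sum>C\<in>D. 3)"
    by simp
  also have "\<dots> \<le> (\<Sum>C\<in>D. card C)"
    by (rule sum_mono) (rule ge)
  also have "\<dots> = card (\<Union>D)"
    by (rule card_Union_disjoint[symmetric])
       (use D fin in \<open>auto simp: disjoint_def pairwise_def disjnt_def\<close>)
  finally show ?thesis
    using D(1) by simp
qed

lemma digraph_span_le_card:
  assumes "finite \<Delta>" and "cycle_decomposition \<Delta> D"
  shows "2 * digraph_span \<Delta> \<le> card \<Delta>"
proof -
  let ?S = "{card D | D. cycle_decomposition \<Delta> D}"
  have le: "3 * m \<le> card \<Delta>" if "m \<in> ?S" for m
    using that cycle_decomposition_card[OF assms(1)] by blast
  have "m \<le> card \<Delta>" if "m \<in> ?S" for m
    using le[OF that] by linarith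
  then have "?S \<subseteq> {..card \<Delta>}"
    by (simp add: subset_iff)
  then have "finite ?S"
    by (rule finite_subset) simp
  moreover have "card D \<in> ?S"
    using assms(2) by blast
  then have "?S \<noteq> {}"
    by (metis empty_iff)
  ultimately have "digraph_span \<Delta> \<in> ?S"
    unfolding digraph_span_def by (rule Max_in)
  from le[OF this] show ?thesis
    by linarith
qed

text \<open>The subtraction does not truncate, by \<open>digraph_span_le_card\<close>.\<close>

definition beta :: "'a rel \<Rightarrow> nat" where
  "beta \<Delta> = card \<Delta> - 2 * digraph_span \<Delta>"

definition reversals :: "'a rel rel" where
  "reversals = {(\<Gamma>, \<Gamma>'). \<exists>C. kcycle 3 C \<and> C \<subseteq> \<Gamma> \<and> \<Gamma>' = (\<Gamma> - C) \<union> C\<inverse>}"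

text \<open>The distance is \<open>\<infinity>\<close> if \<open>\<Gamma>'\<close> cannot be reached from \<open>\<Gamma>\<close>.  Reversing a 3-cycle turns a
  game into a game on the same vertex set, so all intermediate relations are games
  if \<open>\<Gamma>\<close> is one.\<close>

definition game_dist :: "'a rel \<Rightarrow> 'a rel \<Rightarrow> enat" where
  "game_dist \<Gamma> \<Gamma>' = (INF m\<in>{m. (\<Gamma>, \<Gamma>') \<in> reversals ^^ m}. enat m)"

end

theory Submission
  imports Defs
begin

text \<open>
  In a tournament a \<open>k\<close>-cycle with \<open>k > 3\<close> is, up to a chord, the sum of a 3-cycle and a
  \<open>(k - 1)\<close>-cycle, so \<open>k - 2\<close> reversals of 3-cycles reverse it. Reversing the cycles of a
  decomposition of \<open>\<Gamma>\<close> one after another gives \<open>d(\<Gamma>, \<Gamma>\<inverse>) \<le> \<beta>(\<Gamma>)\<close>.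
  Conversely, if \<open>\<Psi>\<close> is reached from \<open>\<Gamma>\<close> by \<open>m\<close> reversals, then \<open>\<Gamma> - \<Psi>\<close> decomposes into at
  least \<open>(|\<Gamma> - \<Psi>| - m) / 2\<close> cycles: a further reversal of a 3-cycle \<open>T\<close> only affects the
  cycles that meet \<open>T\<inverse>\<close>, and what remains of their union together with \<open>T\<close> is balanced.
  For the bound \<open>n\<^sup>2\<close>, two new vertices \<open>a \<rightarrow> b\<close> extending a game on \<open>2 k + 1\<close> vertices split the
  old vertices into \<open>k\<close> with \<open>a \<rightarrow> x \<rightarrow> b\<close> and \<open>k + 1\<close> with \<open>b \<rightarrow> y \<rightarrow> a\<close>; hence the new edges
  form one 3-cycle and \<open>k\<close> 4-cycles. So \<open>\<sigma>(\<Gamma>) \<ge> n (n + 1) / 2\<close>, while \<open>|\<Gamma>| = n (2 n + 1)\<close>.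
\<close>

section \<open>Balanced digraphs and the cycles in them\<close>

text \<open>Out-degree minus in-degree, as one integer sum over the edges: this makes it additive
  over disjoint unions and odd under converse.\<close>

definition excess :: "'a rel \<Rightarrow> 'a \<Rightarrow> int" where
  "excess \<Delta> v = (\<Sum>e\<in>\<Delta>. of_bool (fst e = v) - of_bool (snd e = v))"

text \<open>Finiteness is part of the notion because a sum over an infinite set is 0 by convention,
  so the excess would say nothing there.\<close>

definition balanced :: "'a rel \<Rightarrow> bool" where
  "balanced \<Delta> \<longleftrightarrow> finite \<Delta> \<and> (\<forall>v. excess \<Delta> v = 0)"

lemma excess_Un:
  assumes "finite A" "finite B" "A \<inter> B = {}"
  shows "excess (A \<union> B) v = excess A v + excess B v"
  using assms by (simp add: excess_def sum.union_disjoint)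

lemma excess_Diff:
  assumes "finite A" "B \<subseteq> A"
  shows "excess (A - B) v = excess A v - excess B v"
  using assms by (simp add: excess_def sum_diff)

lemma excess_converse: "excess (A\<inverse>) v = - excess A v"
proof -
  have "excess (A\<inverse>) v = (\<Sum>e\<in>A. of_bool (snd e = v) - of_bool (fst e = v))"
    unfolding excess_def
    by (rule sum.reindex_bij_witness[where i = prod.swap and j = prod.swap]) auto
  also have "\<dots> = - excess A v"
    by (simp add: excess_def flip: sum_negf)
  finally show ?thesis .
qed

lemma balanced_Un:
  assumes "balanced A" "balanced B" "A \<inter> B = {}"
  shows "balanced (A \<union> B)"
  using assms by (simp add: balanced_def excess_Un)

lemma balanced_Diff:
  assumes "balanced A" "balanced B" "B \<subseteq> A"
  shows "balanced (A - B)"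
  using assms by (simp add: balanced_def excess_Diff)

lemma kcycle_finite: "kcycle k C \<Longrightarrow> finite C"
  using card_kcycle[of k C] by (intro card_ge_0_finite) (simp add: kcycle_def)

lemma kcycle_nonempty: "kcycle k C \<Longrightarrow> C \<noteq> {}"
  using card_kcycle[of k C] by (auto simp: kcycle_def)

text \<open>The heads of the edges are the tails shifted cyclically by one index, so the two sums in
  the excess agree.\<close>

lemma balanced_kcycle:
  assumes "kcycle k C"
  shows "balanced C"
proof -
  from assms obtain vs where vs: "length vs = k" "distinct vs" and "3 \<le> k"
    and C: "C = {(vs ! i, vs ! (Suc i mod k)) | i. i < k}"
    unfolding kcycle_def by blast
  have im: "C = (\<lambda>i. (vs ! i, vs ! (Suc i mod k))) ` {..<k}"
    using C by auto
  have inj: "inj_on (\<lambda>i. (vs ! i, vs ! (Suc i mod k))) {..<k}"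
    using vs by (auto simp: inj_on_def nth_eq_iff_index_eq)
  obtain m where m: "k = Suc m"
    using \<open>3 \<le> k\<close> by (cases k) auto
  have "excess C v = 0" for v
  proof -
    let ?h = "\<lambda>i. of_bool (vs ! i = v) :: int"
    have "(\<Sum>i<k. ?h (Suc i mod k)) = (\<Sum>i<m. ?h (Suc i)) + ?h 0"
      unfolding m by simp
    also have "\<dots> = (\<Sum>i<k. ?h i)"
      unfolding m by (subst sum.lessThan_Suc_shift) simp
    finally have "(\<Sum>i<k. ?h (Suc i mod k)) = (\<Sum>i<k. ?h i)" .
    then show ?thesis
      unfolding excess_def im by (subst sum.reindex[OF inj]) (simp add: sum_subtractf)
  qed
  then show ?thesis
    using kcycle_finite[OF assms] by (simp add: balanced_def)
qed

lemma kcycle3I: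
  assumes "distinct [a, b, c]"
  shows "kcycle 3 {(a, b), (b, c), (c, a)}"
  unfolding kcycle_def
proof (intro conjI exI[of _ "[a, b, c]"])
  show "{(a, b), (b, c), (c, a)} =
      {([a, b, c] ! i, [a, b, c] ! (Suc i mod 3)) | i. i < 3}"
    unfolding setcompr_eq_image lessThan_def[symmetric]
    by (simp add: lessThan_nat_numeral lessThan_Suc insert_commute)
qed (use assms in auto)

lemma kcycle4I:
  assumes "distinct [a, b, c, d]"
  shows "kcycle 4 {(a, b), (b, c), (c, d), (d, a)}"
  unfolding kcycle_def
proof (intro conjI exI[of _ "[a, b, c, d]"])
  show "{(a, b), (b, c), (c, d), (d, a)} =
      {([a, b, c, d] ! i, [a, b, c, d] ! (Suc i mod 4)) | i. i < 4}"
    unfolding setcompr_eq_image lessThan_def[symmetric]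
    by (simp add: lessThan_nat_numeral lessThan_Suc insert_commute)
qed (use assms in auto)

text \<open>Without an edge leaving \<open>y\<close> no term of the excess at \<open>y\<close> is
  positive, while \<open>(x, y)\<close> contributes -1.\<close>

lemma balanced_has_successor:
  assumes "balanced \<Delta>" "(x, y) \<in> \<Delta>"
  shows "\<exists>z. (y, z) \<in> \<Delta>"
proof (rule ccontr)
  assume "\<nexists>z. (y, z) \<in> \<Delta>"
  then have "excess \<Delta> y = - (\<Sum>e\<in>\<Delta>. of_bool (snd e = y))"
    unfolding excess_def sum_negf[symmetric] by (intro sum.cong) auto
  moreover have "(of_bool (snd (x, y) = y) :: int) \<le> (\<Sum>e\<in>\<Delta>. of_bool (snd e = y))"
    by (rule member_le_sum) (use assms in \<open>auto simp: balanced_def\<close>)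
  ultimately show False
    using assms(1) by (simp add: balanced_def)
qed

text \<open>Following a chosen successor inside the finite set \<open>Range \<Delta>\<close> must
  repeat a vertex. An orbit of least period is a cycle, and asymmetry rules out the lengths 1 and
  2.\<close>

lemma balanced_contains_kcycle:
  assumes bal: "balanced \<Delta>" and asym: "\<Delta> \<inter> \<Delta>\<inverse> = {}" and "\<Delta> \<noteq> {}"
  shows "\<exists>k C. kcycle k C \<and> C \<subseteq> \<Delta>"
proof -
  define f where "f x = (SOME z. (x, z) \<in> \<Delta>)" for x
  have f: "(x, f x) \<in> \<Delta>" if "x \<in> Range \<Delta>" for x
    using balanced_has_successor[OF bal] that unfolding f_def by (auto intro: someI_ex)
  have fR: "(f ^^ i) x \<in> Range \<Delta>" if "x \<in> Range \<Delta>" for x i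
    by (induction i) (use that f in auto)
  have fin: "finite (Range \<Delta>)"
    using bal by (simp add: balanced_def finite_Range)
  obtain x where x: "x \<in> Range \<Delta>"
    using \<open>\<Delta> \<noteq> {}\<close> by auto
  \<comment> \<open>The least period is taken over all points of \<open>Range \<Delta>\<close>, not
    only for one point. A repetition at indices \<open>i < j < k\<close> would give the point
    \<open>(f ^^ i) y\<close> the period \<open>j - i < k\<close>, so the orbit of \<open>y\<close>
    has distinct entries.\<close>
  define P where "P k \<longleftrightarrow> 0 < k \<and> (\<exists>y\<in>Range \<Delta>. (f ^^ k) y = y)" for k
  have period: "P (j - i)" if "y \<in> Range \<Delta>" "i < j" "(f ^^ i) y = (f ^^ j) y" for i j y
  proof -
    have "(f ^^ (j - i)) ((f ^^ i) y) = (f ^^ i) y"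
      using that(2,3) funpow_add[of "j - i" i f] by (simp add: fun_eq_iff)
    then show ?thesis
      using that(2) fR[OF that(1), of i] by (auto simp: P_def)
  qed
  have "\<not> inj (\<lambda>i. (f ^^ i) x)"
    using fR[OF x] fin by (meson finite_subset image_subsetI range_inj_infinite)
  then obtain i j where ij: "i \<noteq> j" "(f ^^ i) x = (f ^^ j) x"
    unfolding inj_def by blast
  have "\<exists>k. P k"
    using period[OF x, of i j] period[OF x, of j i] ij by (metis nat_neq_iff)
  define k where "k = (LEAST k. P k)"
  have "P k"
    unfolding k_def using \<open>\<exists>k. P k\<close> by (rule LeastI_ex)
  then obtain y where y: "y \<in> Range \<Delta>" "(f ^^ k) y = y" and "0 < k"
    by (auto simp: P_def)
  have min: "\<not> P i" if "i < k" for i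
    using that unfolding k_def by (rule not_less_Least)
  define vs where "vs = map (\<lambda>i. (f ^^ i) y) [0..<k]"
  have vs: "vs ! i = (f ^^ i) y" if "i < k" for i
    using that by (simp add: vs_def)
  have vs': "vs ! (Suc i mod k) = f ((f ^^ i) y)" if "i < k" for i
  proof (cases "Suc i = k")
    case True
    then show ?thesis
      using y(2) vs[OF \<open>0 < k\<close>] by auto
  next
    case False
    then show ?thesis
      using that vs[of "Suc i"] by simp
  qed
  have neq: "(f ^^ i) y \<noteq> (f ^^ j) y" if "i < j" "j < k" for i j
    using period[OF y(1) that(1)] min[of "j - i"] that by auto
  then have "distinct vs"
    unfolding vs_def by (auto simp: distinct_map inj_on_def) (metis nat_neq_iff)
  have irr: "(u, u) \<notin> \<Delta>" and anti: "(u, w) \<in> \<Delta> \<Longrightarrow> (w, u) \<notin> \<Delta>" for u w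
    using asym by auto
  have "k \<noteq> 1"
    using y f[OF y(1)] irr[of y] by auto
  moreover have "k \<noteq> 2"
    using y f[OF y(1)] f[OF fR[OF y(1), of 1]] anti[of y "f y"] by (auto simp: numeral_2_eq_2)
  ultimately have "3 \<le> k"
    using \<open>0 < k\<close> by linarith
  let ?C = "{(vs ! i, vs ! (Suc i mod k)) | i. i < k}"
  have "kcycle k ?C"
    unfolding kcycle_def using \<open>3 \<le> k\<close> \<open>distinct vs\<close>
    by (intro conjI exI[of _ vs]) (auto simp: vs_def)
  moreover have "?C \<subseteq> \<Delta>"
  proof clarify
    fix i
    assume "i < k"
    then show "(vs ! i, vs ! (Suc i mod k)) \<in> \<Delta>"
      using f[OF fR[OF y(1)]] by (simp only: vs vs')
  qed
  ultimately show ?thesis by blast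
qed

section \<open>Cycle decompositions and the span\<close>

lemma cycle_decomposition_Un:
  assumes "cycle_decomposition A D" "cycle_decomposition B E" "A \<inter> B = {}"
  shows "cycle_decomposition (A \<union> B) (D \<union> E)"
proof -
  have "disjoint (D \<union> E)"
    using assms by (intro disjoint_union) (auto simp: cycle_decomposition_def)
  then show ?thesis
    using assms by (auto simp: cycle_decomposition_def)
qed

lemma cycle_decomposition_disjoint:
  assumes "cycle_decomposition A D" "cycle_decomposition B E" "A \<inter> B = {}"
  shows "D \<inter> E = {}"
proof (rule ccontr)
  assume "D \<inter> E \<noteq> {}"
  then obtain C where C: "C \<in> D" "C \<in> E" by blast
  then have "C \<noteq> {}"
    using assms(1) kcycle_nonempty unfolding cycle_decomposition_def by blast
  then show False
    using C assms unfolding cycle_decomposition_def by blast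
qed

lemma cycle_decomposition_finite:
  assumes "cycle_decomposition \<Delta> D" "finite \<Delta>"
  shows "finite D"
  using assms by (auto simp: cycle_decomposition_def intro: finite_UnionD)

lemma cycle_decomposition_card_Un:
  assumes "cycle_decomposition A D" "cycle_decomposition B E" "A \<inter> B = {}"
    and "finite A" "finite B"
  shows "card (D \<union> E) = card D + card E"
  using assms cycle_decomposition_finite cycle_decomposition_disjoint
  by (metis card_Un_disjoint)

lemma cycle_decomposition_kcycle: "kcycle k C \<Longrightarrow> cycle_decomposition C {C}"
  by (auto simp: cycle_decomposition_def)

lemma cycle_decomposition_unique:
  assumes "cycle_decomposition \<Delta> D" "C \<in> D" "C' \<in> D" "e \<in> C" "e \<in> C'"
  shows "C = C'"
  using assms unfolding cycle_decomposition_def disjoint_def by (metis disjoint_iff)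

lemma cycle_decomposition_subset:
  assumes "cycle_decomposition \<Delta> D" "E \<subseteq> D"
  shows "cycle_decomposition (\<Union>E) E"
  using assms pairwise_subset[of disjnt D E]
  by (auto simp: cycle_decomposition_def)

lemma balanced_if_decomposition:
  assumes "finite D" "cycle_decomposition \<Delta> D"
  shows "balanced \<Delta>"
  using assms
proof (induction D arbitrary: \<Delta>)
  case empty
  then show ?case
    by (simp add: cycle_decomposition_def balanced_def excess_def)
next
  case (insert C D)
  have "cycle_decomposition (\<Union>D) D"
    by (rule cycle_decomposition_subset[OF insert.prems]) auto
  then have "balanced (\<Union>D)"
    by (rule insert.IH)
  moreover have "balanced C"
    using insert.prems balanced_kcycle by (auto simp: cycle_decomposition_def)
  moreover have "C \<inter> \<Union>D = {}"
    using insert.prems insert.hyps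
    by (auto simp: cycle_decomposition_def disjoint_def)
  moreover have "\<Delta> = C \<union> \<Union>D"
    using insert.prems by (auto simp: cycle_decomposition_def)
  ultimately show ?case
    by (simp add: balanced_Un)
qed

text \<open>Removing a cycle preserves balance and asymmetry, so cycles can be split off until no
  edge is left.\<close>

lemma balanced_has_decomposition:
  assumes "balanced \<Delta>" "\<Delta> \<inter> \<Delta>\<inverse> = {}"
  shows "\<exists>D. cycle_decomposition \<Delta> D"
proof -
  have "finite \<Delta>"
    using assms(1) by (simp add: balanced_def)
  then show ?thesis
    using assms
  proof (induction \<Delta> rule: finite_psubset_induct)
    case (psubset \<Delta>)
    show ?case
    proof (cases "\<Delta> = {}")
      case True
      then have "cycle_decomposition \<Delta> {}"
        by (simp add: cycle_decomposition_def)
      then show ?thesis ..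
    next
      case False
      then obtain k C where C: "kcycle k C" "C \<subseteq> \<Delta>"
        using balanced_contains_kcycle psubset.prems by blast
      have "balanced (\<Delta> - C)"
        using balanced_Diff psubset.prems(1) balanced_kcycle C by blast
      moreover have "\<Delta> - C \<subset> \<Delta>"
        using C kcycle_nonempty by blast
      moreover have "(\<Delta> - C) \<inter> (\<Delta> - C)\<inverse> = {}"
        using psubset.prems(2) by blast
      ultimately obtain D where "cycle_decomposition (\<Delta> - C) D"
        using psubset.IH by blast
      then have "cycle_decomposition (C \<union> (\<Delta> - C)) ({C} \<union> D)"
        by (intro cycle_decomposition_Un cycle_decomposition_kcycle[OF C(1)]) auto
      moreover have "C \<union> (\<Delta> - C) = \<Delta>"
        using C by auto
      ultimately show ?thesis by auto
    qed
  qed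
qed

text \<open>The number of cycles is bounded by the number of edges and \<open>D\<close> witnesses
  nonemptiness, so the \<open>Max\<close> in the span is a true maximum and is attained.\<close>

lemma digraph_span_max:
  assumes "finite \<Delta>" "cycle_decomposition \<Delta> D"
  shows "card D \<le> digraph_span \<Delta>"
    and "\<exists>E. cycle_decomposition \<Delta> E \<and> card E = digraph_span \<Delta>"
proof -
  let ?S = "{card D | D. cycle_decomposition \<Delta> D}"
  have "?S \<subseteq> {..card \<Delta>}"
    using cycle_decomposition_card[OF assms(1)] by fastforce
  then have fin: "finite ?S"
    by (rule finite_subset) simp
  have mem: "card D \<in> ?S"
    using assms(2) by blast
  show "card D \<le> digraph_span \<Delta>"
    unfolding digraph_span_def using fin mem by (rule Max_ge)
  have "digraph_span \<Delta> \<in> ?S"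
    unfolding digraph_span_def using fin mem by (intro Max_in) auto
  then show "\<exists>E. cycle_decomposition \<Delta> E \<and> card E = digraph_span \<Delta>"
    by auto
qed

subsection \<open>Reversing cycles\<close>

text \<open>One operation for triangles, longer cycles and whole games; taking
  \<open>C = \<Gamma>\<close> gives \<open>\<Gamma>\<inverse>\<close>.\<close>

definition reverse_edges :: "'a rel \<Rightarrow> 'a rel \<Rightarrow> 'a rel" where
  "reverse_edges \<Gamma> C = (\<Gamma> - C) \<union> C\<inverse>"

lemma tournament_iff:
  "tournament I \<Gamma> \<longleftrightarrow> finite I \<and>
    (\<forall>x y. (x, y) \<in> \<Gamma> \<longrightarrow> x \<in> I \<and> y \<in> I \<and> (y, x) \<notin> \<Gamma>) \<and>
    (\<forall>x\<in>I. \<forall>y\<in>I. x \<noteq> y \<longrightarrow> (x, y) \<in> \<Gamma> \<or> (y, x) \<in> \<Gamma>)"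
  (is "?L \<longleftrightarrow> ?R")
proof
  assume L: ?L
  have "x \<in> I \<and> y \<in> I \<and> (y, x) \<notin> \<Gamma>" if "(x, y) \<in> \<Gamma>" for x y
  proof -
    have "x \<in> I" "y \<in> I" "x \<noteq> y"
      using that L unfolding tournament_def irrefl_def by blast+
    then show ?thesis
      using that L unfolding tournament_def by blast
  qed
  then show ?R
    using L unfolding tournament_def by blast
qed (auto simp: tournament_def irrefl_def)

lemma tournament_asym: "tournament I \<Gamma> \<Longrightarrow> (x, y) \<in> \<Gamma> \<Longrightarrow> (y, x) \<notin> \<Gamma>"
  by (simp add: tournament_iff)

lemma tournament_total:
  "tournament I \<Gamma> \<Longrightarrow> x \<in> I \<Longrightarrow> y \<in> I \<Longrightarrow> x \<noteq> y \<Longrightarrow> (x, y) \<notin> \<Gamma> \<Longrightarrow> (y, x) \<in> \<Gamma>"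
  by (auto simp: tournament_iff)

lemma tournament_field: "tournament I \<Gamma> \<Longrightarrow> (x, y) \<in> \<Gamma> \<Longrightarrow> x \<in> I \<and> y \<in> I \<and> x \<noteq> y"
  by (auto simp: tournament_iff)

lemma tournament_finite: "tournament I \<Gamma> \<Longrightarrow> finite \<Gamma>"
  unfolding tournament_def by (meson finite_SigmaI finite_subset)

lemma tournament_reverse_edges:
  assumes "tournament I \<Gamma>" "C \<subseteq> \<Gamma>"
  shows "tournament I (reverse_edges \<Gamma> C)"
  using assms unfolding tournament_iff reverse_edges_def by blast

lemma reverse_edges_reversal:
  "kcycle 3 C \<Longrightarrow> C \<subseteq> \<Gamma> \<Longrightarrow> (\<Gamma>, reverse_edges \<Gamma> C) \<in> reversals"
  by (auto simp: reversals_def reverse_edges_def)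

fun path_edges :: "'a list \<Rightarrow> 'a rel" where
  "path_edges (x # y # r) = insert (x, y) (path_edges (y # r))"
| "path_edges _ = {}"

lemma path_edges_conv_nth: "path_edges xs = (\<lambda>i. (xs ! i, xs ! Suc i)) ` {..<length xs - 1}"
proof (induction xs rule: path_edges.induct)
  case (1 x y r)
  then show ?case
    by (simp add: lessThan_Suc_eq_insert_0 image_image)
qed auto

lemma path_edges_subset: "path_edges (x # xs) \<subseteq> set (x # xs) \<times> set xs"
  by (induction xs arbitrary: x) (simp, force)

lemma path_edges_butlast: "path_edges (xs @ [x]) \<subseteq> set xs \<times> set (xs @ [x])"
  unfolding path_edges_conv_nth by (auto simp: nth_append)

lemma kcycle_path_edges:
  assumes "kcycle k C"
  obtains v vs where "length vs = k - 1" "distinct (v # vs)"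
    "C = path_edges (v # vs @ [v])"
proof -
  from assms obtain us where us: "length us = k" "distinct us" "3 \<le> k"
    and C: "C = {(us ! i, us ! (Suc i mod k)) | i. i < k}"
    unfolding kcycle_def by blast
  then obtain v vs where vvs: "us = v # vs"
    by (cases us) auto
  have "us ! (Suc i mod k) = (us @ [v]) ! Suc i" if "i < k" for i
    using that us vvs by (cases "Suc i = k") (auto simp: nth_append)
  moreover have "us ! i = (us @ [v]) ! i" if "i < k" for i
    using that us by (simp add: nth_append)
  ultimately have "C = path_edges (us @ [v])"
    unfolding C path_edges_conv_nth setcompr_eq_image using us(1)
    by (intro image_cong) auto
  then show ?thesis
    using that us vvs by auto
qed

text \<open>Induction on the length, using the chord between \<open>a\<close> and \<open>c\<close>.
  If it points from \<open>c\<close> to \<open>a\<close>, the triangle \<open>a b c\<close> is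
  reversed first, which turns the chord so that the shorter cycle \<open>a c d ...\<close> is
  present. Otherwise the shorter cycle is reversed first, which makes the triangle available. Either
  way the chord is turned twice and ends as it began.\<close>

lemma reverse_path_edges:
  assumes "tournament I \<Gamma>" "distinct (a # b # c # r)" "path_edges (a # b # c # r @ [a]) \<subseteq> \<Gamma>"
  shows "(\<Gamma>, reverse_edges \<Gamma> (path_edges (a # b # c # r @ [a]))) \<in> reversals ^^ Suc (length r)"
  using assms
proof (induction r arbitrary: \<Gamma> b c)
  case Nil
  then have "(\<Gamma>, reverse_edges \<Gamma> {(a, b), (b, c), (c, a)}) \<in> reversals"
    by (intro reverse_edges_reversal kcycle3I) auto
  then show ?case by simp
next
  case (Cons d r)
  define P where "P = path_edges (c # d # r @ [a])"
  let ?T = "{(a, b), (b, c), (c, a)}"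
  let ?C = "path_edges (a # b # c # (d # r) @ [a])"
  let ?C' = "path_edges (a # c # d # r @ [a])"
  have C: "?C = {(a, b), (b, c)} \<union> P" and C': "?C' = {(a, c)} \<union> P"
    by (auto simp: P_def)
  have sub: "{(a, b), (b, c)} \<union> P \<subseteq> \<Gamma>"
    using Cons.prems(3) unfolding C .
  have dist: "distinct (a # c # d # r)" and abc: "a \<noteq> b" "b \<noteq> c" "a \<noteq> c"
    using Cons.prems(2) by auto
  \<comment> \<open>The remaining path avoids \<open>b\<close>, never leaves \<open>a\<close> and
    does not contain the chord. Hence the reversals of the triangle and of the shorter cycle
    interfere only in the chord.\<close>
  have Pb: "(x, b) \<notin> P" "(b, x) \<notin> P" for x
    using path_edges_subset[of c "d # r @ [a]"] Cons.prems(2) by (auto simp: P_def)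
  have Pa: "(a, x) \<notin> P" for x
    using path_edges_butlast[of "c # d # r" a] Cons.prems(2) by (auto simp: P_def)
  have Pca: "(c, a) \<notin> P"
    using path_edges_subset[of d "r @ [a]"] Cons.prems(2) by (auto simp: P_def)
  note asym = tournament_asym[OF Cons.prems(1)]
  have T: "kcycle 3 ?T"
    using abc by (intro kcycle3I) auto
  have I: "a \<in> I" "c \<in> I"
    using tournament_field[OF Cons.prems(1)] sub by blast+
  show ?case
  proof (cases "(c, a) \<in> \<Gamma>")
    case True
    let ?\<Gamma>1 = "reverse_edges \<Gamma> ?T"
    have T\<Gamma>: "?T \<subseteq> \<Gamma>"
      using True sub by auto
    have "{(a, c)} \<union> P \<subseteq> ?\<Gamma>1"
      using sub Pa Pb Pca by (auto simp: reverse_edges_def)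
    then have "(?\<Gamma>1, reverse_edges ?\<Gamma>1 ?C') \<in> reversals ^^ Suc (length r)"
      unfolding C'[symmetric]
      by (intro Cons.IH tournament_reverse_edges[OF Cons.prems(1) T\<Gamma>] dist)
    moreover have "reverse_edges ?\<Gamma>1 ?C' = reverse_edges \<Gamma> ?C"
      unfolding C C' reverse_edges_def
      using sub True Pa Pb Pca asym abc by auto
    ultimately show ?thesis
      using reverse_edges_reversal[OF T T\<Gamma>] relpow_Suc_I2 by fastforce
  next
    case False
    then have ac: "(a, c) \<in> \<Gamma>"
      using tournament_total[OF Cons.prems(1)] I abc by blast
    let ?\<Gamma>1 = "reverse_edges \<Gamma> ?C'"
    have "?C' \<subseteq> \<Gamma>"
      unfolding C' using sub ac by auto
    then have "(\<Gamma>, ?\<Gamma>1) \<in> reversals ^^ Suc (length r)"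
      by (intro Cons.IH Cons.prems(1) dist)
    moreover have "?T \<subseteq> ?\<Gamma>1"
      unfolding C' reverse_edges_def using sub Pb Pa abc by auto
    then have "(?\<Gamma>1, reverse_edges ?\<Gamma>1 ?T) \<in> reversals"
      by (rule reverse_edges_reversal[OF T])
    moreover have "reverse_edges ?\<Gamma>1 ?T = reverse_edges \<Gamma> ?C"
      unfolding C C' reverse_edges_def
      using sub ac False Pa Pb Pca asym abc by auto
    ultimately show ?thesis
      using relpow_Suc_I by fastforce
  qed
qed

lemma reverse_kcycle:
  assumes "tournament I \<Gamma>" "kcycle k C" "C \<subseteq> \<Gamma>"
  shows "(\<Gamma>, reverse_edges \<Gamma> C) \<in> reversals ^^ (k - 2)"
proof -
  obtain v vs where vs: "length vs = k - 1" "distinct (v # vs)" and C: "C = path_edges (v # vs @ [v])"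
    using kcycle_path_edges[OF assms(2)] .
  have "3 \<le> k"
    using assms(2) by (simp add: kcycle_def)
  then obtain b c r where r: "vs = b # c # r"
    using vs(1) by (cases vs; cases "tl vs") auto
  have "(\<Gamma>, reverse_edges \<Gamma> C) \<in> reversals ^^ Suc (length r)"
    using reverse_path_edges[OF assms(1), of v b c r] vs assms(3) by (simp add: C r)
  moreover have "Suc (length r) = k - 2"
    using vs(1) r \<open>3 \<le> k\<close> by simp
  ultimately show ?thesis by simp
qed

text \<open>The cycles are edge-disjoint, so reversing one leaves the others in place, and the costs
  \<open>k - 2\<close> add up.\<close>

lemma reverse_decomposition:
  assumes "finite D" "tournament I \<Gamma>" "cycle_decomposition \<Delta> D" "\<Delta> \<subseteq> \<Gamma>"
  shows "(\<Gamma>, reverse_edges \<Gamma> \<Delta>) \<in> reversals ^^ (card \<Delta> - 2 * card D)"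
  using assms
proof (induction D arbitrary: \<Gamma> \<Delta>)
  case empty
  then show ?case
    by (simp add: cycle_decomposition_def reverse_edges_def)
next
  case (insert C D)
  have \<Delta>: "\<Delta> = C \<union> \<Union>D"
    using insert.prems by (auto simp: cycle_decomposition_def)
  have disj: "C \<inter> \<Union>D = {}"
    using insert.prems insert.hyps
    by (auto simp: cycle_decomposition_def disjoint_def)
  obtain k where k: "kcycle k C"
    using insert.prems by (auto simp: cycle_decomposition_def)
  have D: "cycle_decomposition (\<Union>D) D"
    by (rule cycle_decomposition_subset[OF insert.prems(2)]) auto
  have fin: "finite \<Delta>"
    using tournament_finite[OF insert.prems(1)] insert.prems(3) finite_subset by blast
  let ?\<Gamma>1 = "reverse_edges \<Gamma> C"
  have "C \<subseteq> \<Gamma>" "\<Union>D \<subseteq> ?\<Gamma>1"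
    using insert.prems(3) disj by (auto simp: \<Delta> reverse_edges_def)
  then have "(\<Gamma>, ?\<Gamma>1) \<in> reversals ^^ (k - 2)"
    and "(?\<Gamma>1, reverse_edges ?\<Gamma>1 (\<Union>D)) \<in> reversals ^^ (card (\<Union>D) - 2 * card D)"
    using reverse_kcycle[OF insert.prems(1) k] insert.IH[OF _ D]
      tournament_reverse_edges[OF insert.prems(1)] by auto
  then have "(\<Gamma>, reverse_edges ?\<Gamma>1 (\<Union>D))
      \<in> reversals ^^ (k - 2 + (card (\<Union>D) - 2 * card D))"
    by (auto simp: relpow_add)
  moreover have "reverse_edges ?\<Gamma>1 (\<Union>D) = reverse_edges \<Gamma> \<Delta>"
    using insert.prems(3) disj tournament_asym[OF insert.prems(1)]
    unfolding \<Delta> reverse_edges_def by blast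
  \<comment> \<open>No subtraction truncates, since every cycle has at least 3 edges.\<close>
  moreover have "k - 2 + (card (\<Union>D) - 2 * card D) = card \<Delta> - 2 * card (insert C D)"
  proof -
    have "card \<Delta> = k + card (\<Union>D)"
      using fin disj card_kcycle[OF k] unfolding \<Delta> by (subst card_Un_disjoint) auto
    moreover have "3 * card D \<le> card (\<Union>D)"
      using cycle_decomposition_card[OF _ D] fin \<Delta> by simp
    moreover have "3 \<le> k"
      using k by (simp add: kcycle_def)
    ultimately show ?thesis
      using insert.hyps by simp
  qed
  ultimately show ?case by simp
qed

subsection \<open>The lower bound on the distance\<close>

text \<open>The deficiency \<open>card \<Delta> - 2 * card D\<close> grows by at most 1 when a
  triangle is added and opposite edges cancel. Cycles disjoint from \<open>T\<inverse>\<close> are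
  kept; the others are merged with \<open>T\<close> and decomposed afresh.\<close>

lemma decomposition_add_triangle:
  assumes fin: "finite \<Delta>" and D: "cycle_decomposition \<Delta> D"
    and T: "kcycle 3 T" and T\<Delta>: "T \<inter> \<Delta> = {}"
    and asym: "\<Delta>' \<inter> \<Delta>'\<inverse> = {}" and \<Delta>': "\<Delta>' = (\<Delta> - T\<inverse>) \<union> (T - \<Delta>\<inverse>)"
  shows "\<exists>D'. cycle_decomposition \<Delta>' D' \<and> card \<Delta>' + 2 * card D \<le> Suc (card \<Delta> + 2 * card D')"
proof -
  define D0 where "D0 = {C \<in> D. C \<inter> T\<inverse> \<noteq> {}}"
  define \<Delta>0 where "\<Delta>0 = \<Union>D0"
  define \<Delta>1 where "\<Delta>1 = \<Union>(D - D0)"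
  \<comment> \<open>\<open>J\<close> holds the edges of \<open>\<Delta>\<close> that cancel against
    \<open>T\<close>, and \<open>R\<close> is what survives of the affected cycles and the
    triangle.\<close>
  define J where "J = \<Delta> \<inter> T\<inverse>"
  define R where "R = (\<Delta>0 - J) \<union> (T - J\<inverse>)"
  have finT: "finite T" and cardT: "card T = 3"
    using T kcycle_finite card_kcycle by auto
  have finD: "finite D"
    using cycle_decomposition_finite[OF D fin] .
  have decs: "cycle_decomposition \<Delta>0 D0" "cycle_decomposition \<Delta>1 (D - D0)"
    unfolding \<Delta>0_def \<Delta>1_def by (auto intro!: cycle_decomposition_subset[OF D] simp: D0_def)
  have "\<Union>D = \<Delta>"
    using D by (simp add: cycle_decomposition_def)
  then have \<Delta>01: "\<Delta> = \<Delta>0 \<union> \<Delta>1"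
    unfolding \<Delta>0_def \<Delta>1_def D0_def by blast
  have disj: "\<Delta>0 \<inter> \<Delta>1 = {}"
    using cycle_decomposition_unique[OF D] unfolding \<Delta>0_def \<Delta>1_def D0_def by blast
  have \<Delta>1T: "\<Delta>1 \<inter> T\<inverse> = {}"
    unfolding \<Delta>1_def D0_def by blast
  have J: "J \<subseteq> \<Delta>0" "J\<inverse> \<subseteq> T" "finite J"
    using \<Delta>01 \<Delta>1T fin by (auto simp: J_def)
  have \<Delta>'_eq: "\<Delta>' = \<Delta>1 \<union> R" and R\<Delta>1: "\<Delta>1 \<inter> R = {}"
    unfolding \<Delta>' R_def using \<Delta>01 disj \<Delta>1T T\<Delta> by (auto simp: J_def)
  have fin0: "finite \<Delta>0" "finite \<Delta>1"
    using fin \<Delta>01 by auto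
  have finR: "finite R"
    using fin0 finT by (simp add: R_def)
  have "balanced R"
    unfolding balanced_def
  proof (intro conjI allI finR)
    fix v
    have "excess R v = excess (\<Delta>0 - J) v + excess (T - J\<inverse>) v"
      unfolding R_def by (rule excess_Un) (use fin0 finT T\<Delta> \<Delta>01 in auto)
    \<comment> \<open>The excess lost with \<open>J\<close> is regained with
      \<open>J\<inverse>\<close>.\<close>
    also have "\<dots> = excess \<Delta>0 v + excess T v"
      using fin0 finT J by (simp add: excess_Diff excess_converse)
    also have "\<dots> = 0"
      using balanced_if_decomposition[OF _ decs(1)] balanced_kcycle[OF T] finD
      by (simp add: balanced_def D0_def)
    finally show "excess R v = 0" .
  qed
  moreover have "R \<inter> R\<inverse> = {}"
    using asym \<Delta>'_eq by blast
  ultimately obtain E where E: "cycle_decomposition R E"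
    using balanced_has_decomposition by blast
  let ?D' = "(D - D0) \<union> E"
  have D': "cycle_decomposition \<Delta>' ?D'"
    unfolding \<Delta>'_eq using decs(2) E R\<Delta>1 by (rule cycle_decomposition_Un)
  have "card ?D' = card (D - D0) + card E"
    using decs(2) E R\<Delta>1 fin0(2) finR by (rule cycle_decomposition_card_Un)
  moreover have "card D = card (D - D0) + card D0"
    using finD by (subst card_Un_disjoint[symmetric]) (auto simp: D0_def intro: arg_cong[of _ _ card])
  moreover have "card R + 2 * card J = card \<Delta>0 + 3"
  proof -
    have "card R = card (\<Delta>0 - J) + card (T - J\<inverse>)"
      unfolding R_def by (rule card_Un_disjoint) (use fin0 finT T\<Delta> \<Delta>01 in auto)
    moreover have "card (J\<inverse>) = card J"
      by simp
    moreover have "card (\<Delta>0 - J) = card \<Delta>0 - card J" "card J \<le> card \<Delta>0"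
      using J fin0 by (auto simp: card_Diff_subset intro: card_mono)
    moreover have "card (T - J\<inverse>) = 3 - card (J\<inverse>)" "card (J\<inverse>) \<le> 3"
      using J finT cardT card_mono[OF finT J(2)] by (auto simp: card_Diff_subset)
    ultimately show ?thesis by linarith
  qed
  moreover have "card \<Delta>' = card \<Delta>1 + card R" "card \<Delta> = card \<Delta>0 + card \<Delta>1"
    unfolding \<Delta>'_eq \<Delta>01 using R\<Delta>1 disj fin0 finR by (auto intro: card_Un_disjoint)
  \<comment> \<open>Since \<open>R\<close> has \<open>card \<Delta>0 + 3 - 2 * card J\<close> edges,
    this is exactly the inequality needed. If \<open>R\<close> is empty, then
    \<open>\<Delta>0\<close> has 3 edges and \<open>D0\<close> at most one cycle. Otherwise
    \<open>E\<close> has a cycle, and disjoint cycles of \<open>D0\<close> contain distinct edges of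
    \<open>J\<close>.\<close>
  moreover have "Suc (card D0) \<le> card J + card E"
  proof (cases "R = {}")
    case True
    then have "T = J\<inverse>" "\<Delta>0 = J"
      using J by (auto simp: R_def)
    moreover from this have "card J = 3"
      using cardT by (metis card_inverse)
    ultimately show ?thesis
      using cycle_decomposition_card[OF fin0(1) decs(1)] by simp
  next
    case False
    then have "E \<noteq> {}"
      using E by (auto simp: cycle_decomposition_def)
    then have "card E \<noteq> 0"
      using cycle_decomposition_finite[OF E finR] by simp
    moreover have "card D0 \<le> card J"
    proof -
      have "\<exists>e. e \<in> C \<inter> J" if "C \<in> D0" for C
        using that \<open>\<Union>D = \<Delta>\<close> unfolding D0_def J_def by blast
      then obtain g where g: "\<And>C. C \<in> D0 \<Longrightarrow> g C \<in> C \<inter> J"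
        by metis
      have "inj_on g D0"
        using g cycle_decomposition_unique[OF decs(1)] by (metis IntD1 inj_onI)
      moreover have "g ` D0 \<subseteq> J"
        using g by auto
      ultimately show ?thesis
        using J(3) by (metis card_inj_on_le)
    qed
    ultimately show ?thesis by linarith
  qed
  ultimately have "card \<Delta>' + 2 * card D \<le> Suc (card \<Delta> + 2 * card ?D')"
    by linarith
  then show ?thesis
    using D' by blast
qed

text \<open>The edges of \<open>\<Gamma>\<close> that are currently turned form
  \<open>\<Gamma> - \<Psi>\<close>; each reversal adds one triangle to them and so raises the
  deficiency by at most 1.\<close>

lemma reversals_decomposition:
  assumes "tournament I \<Gamma>" "(\<Gamma>, \<Psi>) \<in> reversals ^^ m"
  shows "tournament I \<Psi> \<and>
    (\<exists>D. cycle_decomposition (\<Gamma> - \<Psi>) D \<and> card (\<Gamma> - \<Psi>) \<le> m + 2 * card D)"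
  using assms(2)
proof (induction m arbitrary: \<Psi>)
  case 0
  then have "cycle_decomposition (\<Gamma> - \<Psi>) {}"
    by (simp add: cycle_decomposition_def)
  then show ?case
    using 0 assms(1) by auto
next
  case (Suc m)
  from Suc.prems obtain \<Psi>0 where \<Psi>0: "(\<Gamma>, \<Psi>0) \<in> reversals ^^ m" "(\<Psi>0, \<Psi>) \<in> reversals"
    by auto
  then obtain T where T: "kcycle 3 T" "T \<subseteq> \<Psi>0" and \<Psi>: "\<Psi> = reverse_edges \<Psi>0 T"
    by (auto simp: reversals_def reverse_edges_def)
  have tour: "tournament I \<Psi>0"
    using Suc.IH[OF \<Psi>0(1)] by blast
  obtain D where D: "cycle_decomposition (\<Gamma> - \<Psi>0) D" "card (\<Gamma> - \<Psi>0) \<le> m + 2 * card D"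
    using Suc.IH[OF \<Psi>0(1)] by blast
  have fin: "finite (\<Gamma> - \<Psi>0)"
    using tournament_finite[OF assms(1)] by simp
  have "T \<inter> (\<Gamma> - \<Psi>0) = {}"
    using T(2) by auto
  moreover have "(\<Gamma> - \<Psi>) \<inter> (\<Gamma> - \<Psi>)\<inverse> = {}"
    using tournament_asym[OF assms(1)] by auto
  \<comment> \<open>An edge of \<open>T\<close> either lies in \<open>\<Gamma>\<close> and is newly
    turned, or is the converse of a turned edge and is turned back.\<close>
  moreover have "\<Gamma> - \<Psi> = ((\<Gamma> - \<Psi>0) - T\<inverse>) \<union> (T - (\<Gamma> - \<Psi>0)\<inverse>)"
  proof -
    have "(x, y) \<in> \<Gamma> - \<Psi> \<longleftrightarrow> (x, y) \<in> ((\<Gamma> - \<Psi>0) - T\<inverse>) \<union> (T - (\<Gamma> - \<Psi>0)\<inverse>)" for x y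
      using T(2) tournament_asym[OF assms(1), of x y] tournament_asym[OF tour, of x y]
        tournament_asym[OF tour, of y x]
        tournament_field[OF tour, of x y] tournament_total[OF assms(1), of y x]
      unfolding \<Psi> reverse_edges_def by blast
    then show ?thesis by auto
  qed
  ultimately obtain D' where D': "cycle_decomposition (\<Gamma> - \<Psi>) D'"
      "card (\<Gamma> - \<Psi>) + 2 * card D \<le> Suc (card (\<Gamma> - \<Psi>0) + 2 * card D')"
    using decomposition_add_triangle[OF fin D(1) T(1)] by blast
  then have "card (\<Gamma> - \<Psi>) \<le> Suc m + 2 * card D'"
    using D(2) by linarith
  then show ?case
    using D'(1) tournament_reverse_edges[OF tour T(2)] \<Psi> by blast
qed

section \<open>The distance from a tournament to its converse\<close>

text \<open>A decomposition with \<open>digraph_span \<Gamma>\<close> cycles gives a sequence of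
  \<open>beta \<Gamma>\<close> reversals. For the lower bound the invariant is read at
  \<open>\<Psi> = \<Gamma>\<inverse>\<close>, where every edge is turned.\<close>

lemma game_dist_converse:
  assumes tour: "tournament I \<Gamma>" and dec: "cycle_decomposition \<Gamma> D"
  shows "game_dist \<Gamma> (\<Gamma>\<inverse>) = enat (beta \<Gamma>)"
proof -
  have fin: "finite \<Gamma>"
    using tournament_finite[OF tour] .
  obtain E where E: "cycle_decomposition \<Gamma> E" "card E = digraph_span \<Gamma>"
    using digraph_span_max(2)[OF fin dec] by blast
  have "(\<Gamma>, reverse_edges \<Gamma> \<Gamma>) \<in> reversals ^^ (card \<Gamma> - 2 * card E)"
    using reverse_decomposition[OF cycle_decomposition_finite[OF E(1) fin] tour E(1)] by simp
  then have up: "(\<Gamma>, \<Gamma>\<inverse>) \<in> reversals ^^ beta \<Gamma>"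
    by (simp add: E(2) beta_def reverse_edges_def)
  have low: "beta \<Gamma> \<le> m" if m: "(\<Gamma>, \<Gamma>\<inverse>) \<in> reversals ^^ m" for m
  proof -
    have "\<Gamma> - \<Gamma>\<inverse> = \<Gamma>"
      using tournament_asym[OF tour] by auto
    then obtain F where "cycle_decomposition \<Gamma> F" "card \<Gamma> \<le> m + 2 * card F"
      using reversals_decomposition[OF tour m] by auto
    then show ?thesis
      using digraph_span_max(1)[OF fin] by (fastforce simp: beta_def)
  qed
  show ?thesis
    unfolding game_dist_def
    by (intro antisym INF_lower INF_greatest) (use up low in auto)
qed

subsection \<open>Completely reducible games\<close>

text \<open>Each pair \<open>x\<close> in \<open>A\<close>, \<open>y\<close> in \<open>B\<close>
  gives a 4-cycle through \<open>a\<close>, \<open>x\<close>, \<open>b\<close>, \<open>y\<close>;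
  the one vertex of \<open>B\<close> left over closes a triangle with the edge
  \<open>(a, b)\<close>.\<close>

lemma two_vertex_extension_decomposition:
  assumes "finite A" "finite B" "card B = Suc (card A)" "A \<inter> B = {}"
    and "a \<noteq> b" "a \<notin> A \<union> B" "b \<notin> A \<union> B"
  shows "\<exists>D. cycle_decomposition
      ({(a, b)} \<union> {a} \<times> A \<union> A \<times> {b} \<union> {b} \<times> B \<union> B \<times> {a}) D \<and> card D = Suc (card A)"
  using assms
proof (induction A arbitrary: B)
  case empty
  then obtain z where z: "B = {z}"
    by (auto simp: card_Suc_eq)
  let ?C = "{(a, b), (b, z), (z, a)}"
  have "cycle_decomposition ?C {?C}"
    using empty z by (intro cycle_decomposition_kcycle[OF kcycle3I]) auto
  moreover have "?C = {(a, b)} \<union> {a} \<times> {} \<union> {} \<times> {b} \<union> {b} \<times> B \<union> B \<times> {a}"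
    using z by auto
  ultimately show ?case
    by (intro exI[of _ "{?C}"]) simp
next
  case (insert x A)
  obtain y where y: "y \<in> B"
    using insert.prems by fastforce
  let ?N = "{(a, b)} \<union> {a} \<times> A \<union> A \<times> {b} \<union> {b} \<times> (B - {y}) \<union> (B - {y}) \<times> {a}"
  let ?C = "{(a, x), (x, b), (b, y), (y, a)}"
  have "\<exists>D. cycle_decomposition ?N D \<and> card D = Suc (card A)"
    using insert.prems insert.hyps y by (intro insert.IH) auto
  then obtain D where D: "cycle_decomposition ?N D" "card D = Suc (card A)"
    by blast
  have C: "cycle_decomposition ?C {?C}"
    using insert.prems y by (intro cycle_decomposition_kcycle[OF kcycle4I]) auto
  have disj: "?C \<inter> ?N = {}"
    using insert.prems insert.hyps y by auto
  have "finite ?N"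
    using insert.prems insert.hyps by auto
  then have "card ({?C} \<union> D) = card {?C} + card D"
    by (intro cycle_decomposition_card_Un[OF C D(1) disj]) simp_all
  moreover have "?C \<union> ?N = {(a, b)} \<union> {a} \<times> insert x A \<union> insert x A \<times> {b} \<union> {b} \<times> B \<union> B \<times> {a}"
    using y by auto
  ultimately show ?case
    using cycle_decomposition_Un[OF C D(1) disj] D(2) insert.hyps
    by (intro exI[of _ "{?C} \<union> D"]) simp
qed

text \<open>The degree conditions force the edges at the two new vertices into the pattern of
  \<open>two_vertex_extension_decomposition\<close>, which adds \<open>Suc k\<close> cycles.\<close>

lemma game_extension_decomposition:
  assumes L: "game (Suc k) L G" and K: "game k K (G \<inter> (K \<times> K))" and "K \<subseteq> L"
    and D: "cycle_decomposition (G \<inter> (K \<times> K)) D"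
  shows "\<exists>E. cycle_decomposition G E \<and> card E = card D + Suc k"
proof -
  have tour: "tournament L G"
    using L by (simp add: game_def)
  note asym = tournament_asym[OF tour] and total = tournament_total[OF tour]
    and field = tournament_field[OF tour]
  have finL: "finite L" and finK: "finite K"
    using tour \<open>K \<subseteq> L\<close> finite_subset by (auto simp: tournament_def)
  have cardK: "card K = 2 * k + 1" and cardL: "card L = 2 * k + 3"
    using L K by (auto simp: game_def)
  have "card (L - K) = 2"
    using finK \<open>K \<subseteq> L\<close> cardK cardL by (simp add: card_Diff_subset)
  then obtain u w where uw: "L - K = {u, w}" "u \<noteq> w"
    by (auto simp: card_2_iff)
  obtain a b where ab: "L - K = {a, b}" "a \<noteq> b" "(a, b) \<in> G"
    using uw total[of u w] by (cases "(u, w) \<in> G") auto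
  have abL: "a \<in> L" "b \<in> L" "a \<notin> K" "b \<notin> K" and L_eq: "L = K \<union> {a, b}"
    using ab \<open>K \<subseteq> L\<close> by auto
  \<comment> \<open>The out-degree of an old vertex rises from \<open>k\<close> to
    \<open>Suc k\<close>, so exactly one of its edges to the new vertices points outward.\<close>
  have one: "(x, a) \<in> G \<longleftrightarrow> (x, b) \<notin> G" if x: "x \<in> K" for x
  proof -
    have "card {j. (x, j) \<in> G} = Suc k" "card {j. (x, j) \<in> G \<inter> (K \<times> K)} = k"
      using L K x \<open>K \<subseteq> L\<close> unfolding game_def by blast+
    moreover have "card {j. (x, j) \<in> G} =
        card ({j. (x, j) \<in> G \<inter> (K \<times> K)} \<union> {j \<in> {a, b}. (x, j) \<in> G})"
      by (rule arg_cong[of _ _ card]) (use field x L_eq in blast)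
    moreover have "card ({j. (x, j) \<in> G \<inter> (K \<times> K)} \<union> {j \<in> {a, b}. (x, j) \<in> G})
        = card {j. (x, j) \<in> G \<inter> (K \<times> K)} + card {j \<in> {a, b}. (x, j) \<in> G}"
      using abL finK by (intro card_Un_disjoint) (auto intro: finite_subset[of _ K])
    ultimately have "card {j \<in> {a, b}. (x, j) \<in> G} = 1"
      by linarith
    moreover have "{j \<in> {a, b}. (x, j) \<in> G} =
        (if (x, a) \<in> G then {a} else {}) \<union> (if (x, b) \<in> G then {b} else {})"
      by auto
    ultimately show ?thesis
      using ab(2) by (auto split: if_splits)
  qed
  define A where "A = {x \<in> K. (a, x) \<in> G}"
  define B where "B = {x \<in> K. (b, x) \<in> G}"
  have mem: "(a, x) \<in> G \<longleftrightarrow> (x, a) \<notin> G" "(b, x) \<in> G \<longleftrightarrow> (x, b) \<notin> G" if "x \<in> K" for x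
    using that abL asym total L_eq by blast+
  have AB: "A \<inter> B = {}" "A \<union> B = K"
    using one mem by (auto simp: A_def B_def)
  have finAB: "finite A" "finite B"
    using AB finK by auto
  \<comment> \<open>As \<open>a\<close> beats \<open>b\<close>, all \<open>Suc k\<close> outputs of
    \<open>b\<close> are old vertices; this fixes the sizes of \<open>B\<close> and
    \<open>A\<close>.\<close>
  have "{j. (b, j) \<in> G} = B"
    using field asym ab(3) L_eq by (auto simp: B_def)
  then have cardB: "card B = Suc k"
    using L abL(2) unfolding game_def by auto
  then have cardA: "card A = k"
    using card_Un_disjoint[OF finAB AB(1)] AB(2) cardK by simp
  let ?N = "{(a, b)} \<union> {a} \<times> A \<union> A \<times> {b} \<union> {b} \<times> B \<union> B \<times> {a}"
  obtain E where E: "cycle_decomposition ?N E" "card E = Suc k"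
    using two_vertex_extension_decomposition[OF finAB, of a b] AB abL ab(2) cardA cardB by auto
  have edge: "(a, x) \<in> G \<longleftrightarrow> x \<in> A" "(x, b) \<in> G \<longleftrightarrow> x \<in> A"
    "(b, x) \<in> G \<longleftrightarrow> x \<in> B" "(x, a) \<in> G \<longleftrightarrow> x \<in> B" if "x \<in> K" for x
    using that one mem by (simp_all add: A_def B_def)
  have G_eq: "G = (G \<inter> (K \<times> K)) \<union> ?N"
  proof (intro equalityI subrelI)
    fix x y
    assume "(x, y) \<in> G"
    moreover have "(b, a) \<notin> G" "x \<noteq> y" "x \<in> K \<or> x = a \<or> x = b" "y \<in> K \<or> y = a \<or> y = b"
      using field[OF \<open>(x, y) \<in> G\<close>] asym[OF ab(3)] L_eq by auto
    ultimately show "(x, y) \<in> (G \<inter> (K \<times> K)) \<union> ?N"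
      using edge by auto
  next
    fix x y
    assume "(x, y) \<in> (G \<inter> (K \<times> K)) \<union> ?N"
    then show "(x, y) \<in> G"
      using edge ab(3) AB(2) by auto
  qed
  have disj: "(G \<inter> (K \<times> K)) \<inter> ?N = {}"
    using abL by auto
  have "cycle_decomposition G (D \<union> E)"
    using cycle_decomposition_Un[OF D E(1) disj] G_eq by metis
  moreover have "card (D \<union> E) = card D + card E"
    using finK finAB by (intro cycle_decomposition_card_Un[OF D E(1) disj]) auto
  ultimately show ?thesis
    using E(2) by auto
qed

text \<open>Step \<open>k\<close> of the chain contributes \<open>k\<close> cycles, and these add up
  to \<open>n * (n + 1)\<close> halved; the equation is doubled to avoid division.\<close>

lemma completely_reducible_decomposition:
  assumes "completely_reducible n I \<Gamma>"
  shows "\<exists>D. cycle_decomposition \<Gamma> D \<and> 2 * card D = n * (n + 1)"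
proof -
  from assms obtain J where Jn: "J n = I" and gI: "game n I \<Gamma>"
    and J: "\<And>k. k \<in> {1..<n} \<Longrightarrow> J k \<subseteq> J (Suc k)"
      "\<And>k. k \<in> {1..n} \<Longrightarrow> game k (J k) (\<Gamma> \<inter> (J k \<times> J k))"
    unfolding completely_reducible_def by blast
  have irr: "(x, x) \<notin> \<Gamma>" and \<Gamma>I: "\<Gamma> \<inter> (I \<times> I) = \<Gamma>" for x
    using gI by (auto simp: game_def tournament_def irrefl_def)
  \<comment> \<open>The chain is extended down to a one-vertex game \<open>{v}\<close>. For positive
    \<open>n\<close> the vertex must lie in \<open>J 1\<close>; for \<open>n = 0\<close> the index
    \<open>min 1 n\<close> gives \<open>J 0 = I\<close>, so that \<open>{v}\<close> is all of
    \<open>I\<close>.\<close>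
  have "card (J (min 1 n)) > 0"
    using J(2)[of 1] gI Jn by (cases n) (auto simp: game_def)
  then obtain v where v: "v \<in> J (min 1 n)"
    by fastforce
  define H where "H = J(0 := {v})"
  have H: "game k (H k) (\<Gamma> \<inter> (H k \<times> H k))" if "k \<le> n" for k
  proof (cases k)
    case 0
    have "\<Gamma> \<inter> ({v} \<times> {v}) = {}"
      using irr by auto
    then show ?thesis
      using 0 by (simp add: H_def game_def tournament_iff)
  qed (use that J(2)[of k] in \<open>simp add: H_def\<close>)
  have Hsub: "H k \<subseteq> H (Suc k)" if "k < n" for k
    using that J(1)[of k] v by (cases k) (auto simp: H_def)
  have Hn: "H n = I"
  proof (cases n)
    case 0
    then have "card I = 1"
      using gI by (simp add: game_def)
    then show ?thesis
      using 0 v Jn by (auto simp: H_def card_1_singleton_iff)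
  qed (use Jn in \<open>simp add: H_def\<close>)
  have "\<exists>D. cycle_decomposition (\<Gamma> \<inter> (H k \<times> H k)) D \<and> 2 * card D = k * (k + 1)" if "k \<le> n" for k
    using that
  proof (induction k)
    case 0
    have "cycle_decomposition (\<Gamma> \<inter> (H 0 \<times> H 0)) {}"
      using irr by (auto simp: cycle_decomposition_def H_def)
    then show ?case by auto
  next
    case (Suc k)
    then obtain D where D: "cycle_decomposition (\<Gamma> \<inter> (H k \<times> H k)) D" "2 * card D = k * (k + 1)"
      by auto
    have sub: "H k \<subseteq> H (Suc k)"
      using Hsub Suc.prems by auto
    then have "(\<Gamma> \<inter> (H (Suc k) \<times> H (Suc k))) \<inter> (H k \<times> H k) = \<Gamma> \<inter> (H k \<times> H k)"
      by auto
    then obtain E where "cycle_decomposition (\<Gamma> \<inter> (H (Suc k) \<times> H (Suc k))) E"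
        "card E = card D + Suc k"
      using game_extension_decomposition[OF H[OF Suc.prems] _ sub] H[of k] D(1) Suc.prems
      by (metis Suc_leD)
    then show ?case
      using D(2) by (intro exI[of _ E]) auto
  qed
  from this[of n] show ?thesis
    using Hn \<Gamma>I by simp
qed

section \<open>The edge count and the quadratic bound\<close>

lemma card_game:
  assumes "game n I \<Gamma>"
  shows "card \<Gamma> = n * (2 * n + 1)"
proof -
  have fin: "finite I" and sub: "\<Gamma> \<subseteq> I \<times> I"
    using assms by (auto simp: game_def tournament_def)
  have "\<Gamma> = (SIGMA i:I. {j. (i, j) \<in> \<Gamma>})"
    using sub by auto
  then have "card \<Gamma> = card (SIGMA i:I. {j. (i, j) \<in> \<Gamma>})"
    by (rule arg_cong)
  also have "\<dots> = (\<Sum>i\<in>I. card {j. (i, j) \<in> \<Gamma>})"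
    using fin sub by (intro card_SigmaI) (auto intro: finite_subset[of _ I])
  also have "\<dots> = (\<Sum>i\<in>I. n)"
    using assms by (intro sum.cong) (auto simp: game_def)
  also have "\<dots> = n * (2 * n + 1)"
    using assms by (simp add: game_def)
  finally show ?thesis .
qed

theorem proposition5p9:
  fixes n :: nat and I :: "'a set" and \<Gamma> :: "'a rel"
  assumes "completely_reducible n I \<Gamma>"
  shows "game_dist \<Gamma> (\<Gamma>\<inverse>) = enat (beta \<Gamma>) \<and> beta \<Gamma> \<le> n\<^sup>2"
proof -
  have game: "game n I \<Gamma>"
    using assms by (simp add: completely_reducible_def)
  then have tour: "tournament I \<Gamma>"
    by (simp add: game_def)
  obtain D where D: "cycle_decomposition \<Gamma> D" "2 * card D = n * (n + 1)"
    using completely_reducible_decomposition[OF assms] by blast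
  have "card D \<le> digraph_span \<Gamma>"
    using digraph_span_max(1)[OF tournament_finite[OF tour] D(1)] .
  \<comment> \<open>The left side is the number of edges, and \<open>n * (n + 1)\<close> is at most
    twice the span; the difference leaves the square.\<close>
  moreover have "n * (2 * n + 1) = n\<^sup>2 + n * (n + 1)"
    by (simp add: power2_eq_square algebra_simps)
  ultimately have "beta \<Gamma> \<le> n\<^sup>2"
    using D(2) card_game[OF game] unfolding beta_def by linarith
  then show ?thesis
    using game_dist_converse[OF tour D(1)] by blast
qed

end
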